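(* Let $L$ be a language over a finite alphabet $X$ (that is, $L\subseteq X^*$) with $\epsilon\in L$. Then $L$ is a growing context-sensitive language if and only if $L$ is the language of some non-deterministic Cannon's algorithm $(X,\mathbb{A},\mathcal{R})$.
   Context: For a finite set $A$, $A^*$ denotes the set of all words over $A$, including the empty word $\epsilon$; $A^+=A^*\setminus\{\epsilon\}$; and $|w|$ denotes the length of a word $w$. A phrase-structure grammar is a quadruple $(N,X,\sigma,\mathcal{P})$, where $N$ and $X$ are disjoint finite sets (the non-terminals and the terminals), $\sigma\in N$ is the start symbol, and $\mathcal{P}$ is a finite set of productions $u\rightarrow v$ with $u\in\mathbb{A}^+$, $v\in\mathbb{A}^*$, where $\mathbb{A}:=N\cup X$. The grammar is context-sensitive if $|u|\le|v|$ for all productions $u\rightarrow v$. It is growing context-sensitive if, in addition, for all productions $u\rightarrow v$, $\sigma$ does not occur in $v$ and either $u=\sigma$ or $|u|<|v|$. As an exception to these conditions, a production $\sigma\rightarrow\epsilon$ is also allowed, provided that $\sigma$ does not occur in the right hand side of any production. Write $u\rightarrow^* v$ if $v$ can be derived from $u$ by applying a finite sequence of productions to substrings. The language of the grammar is the set of words $w\in X^*$ with $\sigma\rightarrow^* w$. A growing context-sensitive language is a language defined by a growing context-sensitive grammar. A non-deterministic Cannon's algorithm (NCA) is a triple $(X,\mathbb{A},\mathcal{R})$, where $X\subseteq \mathbb{A}$ are finite alphabets and $\mathcal{R}$ is a finite set of rules of the form $v\rightarrow u$ with $u,v\in \mathbb{A}^*$ and $|v|>|u|$. Distinct rules are allowed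 to have the same left hand side. Some of the rules may be anchored on the left, on the right, or on both sides. A non-anchored rule $v \rightarrow u$ may be applied to any occurrence of $v$ as a subword, replacing that occurrence by $u$. A rule $v \rightarrow u$ anchored on the left, on the right, or on both sides may be applied only to the indicated subword $v$ in words of the form $vw$, $wv$, or $v$, respectively, with $w\in\mathbb{A}^*$ (giving $uw$, $wu$, or $u$). Write $w\rightarrow^* w'$ if $w'$ can be obtained from $w$ by a finite sequence (possibly empty) of rule applications. The language of the NCA is the set of words $w\in X^*$ with $w\rightarrow^*\epsilon$. *)

theory Defs
  imports Main
begin

record 's grammar =
  nonterminals :: "'s set"
  terminals :: "'s set"
  start :: 's
  productions :: "('s list \<times> 's list) set"

definition grammar_alphabet :: "'s grammar \<Rightarrow> 's set" where
  "grammar_alphabet G = nonterminals G \<union> terminals G"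

definition phrase_structure_grammar :: "'s grammar \<Rightarrow> bool" where
  "phrase_structure_grammar G \<longleftrightarrow>
     finite (nonterminals G) \<and> finite (terminals G) \<and>
     nonterminals G \<inter> terminals G = {} \<and>
     start G \<in> nonterminals G \<and>
     finite (productions G) \<and>
     (\<forall>(u, v) \<in> productions G.
        u \<in> lists (grammar_alphabet G) \<and> u \<noteq> [] \<and> v \<in> lists (grammar_alphabet G))"

definition exceptional_production :: "'s grammar \<Rightarrow> 's list \<Rightarrow> 's list \<Rightarrow> bool" where
  "exceptional_production G u v \<longleftrightarrow>
     u = [start G] \<and> v = [] \<and> (\<forall>(u', v') \<in> productions G. start G \<notin> set v')"

definition context_sensitive :: "'s grammar \<Rightarrow> bool" where
  "context_sensitive G \<longleftrightarrow>
     phrase_structure_grammar G \<and>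
     (\<forall>(u, v) \<in> productions G. exceptional_production G u v \<or> length u \<le> length v)"

definition growing_context_sensitive :: "'s grammar \<Rightarrow> bool" where
  "growing_context_sensitive G \<longleftrightarrow>
     context_sensitive G \<and>
     (\<forall>(u, v) \<in> productions G.
        exceptional_production G u v \<or>
        start G \<notin> set v \<and> (u = [start G] \<or> length u < length v))"

definition grammar_step :: "'s grammar \<Rightarrow> 's list \<Rightarrow> 's list \<Rightarrow> bool" where
  "grammar_step G w w' \<longleftrightarrow>
     (\<exists>(u, v) \<in> productions G. \<exists>x y. w = x @ u @ y \<and> w' = x @ v @ y)"

definition grammar_language :: "'s grammar \<Rightarrow> 's list set" where
  "grammar_language G = {w \<in> lists (terminals G). (grammar_step G)\<^sup>*\<^sup>* [start G] w}"

record 's nca_rule =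
  lhs :: "'s list"
  rhs :: "'s list"
  left_anchored :: bool
  right_anchored :: bool

record 's nca =
  input_alphabet :: "'s set"
  full_alphabet :: "'s set"
  rules :: "'s nca_rule set"

definition cannon_algorithm :: "'s nca \<Rightarrow> bool" where
  "cannon_algorithm M \<longleftrightarrow>
     finite (full_alphabet M) \<and> input_alphabet M \<subseteq> full_alphabet M \<and>
     finite (rules M) \<and>
     (\<forall>r \<in> rules M. lhs r \<in> lists (full_alphabet M) \<and> rhs r \<in> lists (full_alphabet M) \<and>
        length (lhs r) > length (rhs r))"

definition nca_step :: "'s nca \<Rightarrow> 's list \<Rightarrow> 's list \<Rightarrow> bool" where
  "nca_step M w w' \<longleftrightarrow>
     (\<exists>r \<in> rules M. \<exists>x \<in> lists (full_alphabet M). \<exists>y \<in> lists (full_alphabet M).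
        w = x @ lhs r @ y \<and> w' = x @ rhs r @ y \<and>
        (left_anchored r \<longrightarrow> x = []) \<and> (right_anchored r \<longrightarrow> y = []))"

definition nca_language :: "'s nca \<Rightarrow> 's list set" where
  "nca_language M = {w \<in> lists (input_alphabet M). (nca_step M)\<^sup>*\<^sup>* w []}"

(* HOL cannot quantify existentially over the type of symbols, and 'a may be finite. The auxiliary
   symbols are therefore taken from 'a + nat, in which X is embedded by Inl. Alphabets being finite,
   every grammar (or NCA) over X is isomorphic, by a renaming that is the embedding on X, to one
   with symbols in this type. *)

definition growing_context_sensitive_language :: "'a set \<Rightarrow> 'a list set \<Rightarrow> bool" where
  "growing_context_sensitive_language X L \<longleftrightarrow>
     (\<exists>G :: ('a + nat) grammar. growing_context_sensitive G \<and> terminals G = Inl ` X \<and>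
        grammar_language G = map Inl ` L)"

definition language_of_nca :: "'a set \<Rightarrow> 'a list set \<Rightarrow> bool" where
  "language_of_nca X L \<longleftrightarrow>
     (\<exists>M :: ('a + nat) nca. cannon_algorithm M \<and> input_alphabet M = Inl ` X \<and>
        nca_language M = map Inl ` L)"

end

theory Submission
  imports Defs
begin

text \<open>
  Reversing a growing production \<open>u \<rightarrow> v\<close> gives a length-reducing rule \<open>v \<rightarrow> u\<close>, so derivations of a
  growing grammar are, read backwards, computations of a Cannon's algorithm. Two discrepancies
  remain.

  From grammar to algorithm: a derivation starts from \<open>\<sigma>\<close>, whereas a computation ends in the empty
  word. As \<open>\<sigma>\<close> never reappears after the first step, a production \<open>\<sigma> \<rightarrow> v\<close> is turned into a rule
  \<open>v \<rightarrow> \<epsilon>\<close> anchored on both sides, which can only be the last one of a computation; that it accepts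
  \<open>\<epsilon>\<close> as well is harmless because \<open>\<epsilon> \<in> L\<close>.

  From algorithm to grammar there are two obstacles. Reversed rules \<open>\<epsilon> \<rightarrow> v\<close> are not productions;
  but a computation reaches \<open>\<epsilon>\<close> only at its very end, so except for the first step of the derivation
  such an insertion happens next to some letter \<open>b\<close>, and \<open>b \<rightarrow> b v\<close> and \<open>b \<rightarrow> v b\<close> are growing.
  Anchored rules require the grammar to recognise the ends of the word, so the first and the last
  letter may carry marks. A mark cannot be erased by a production of its own, since such a
  production would not be growing. Instead every production may drop marks on the way, and the
  derivation guesses when each anchor is used for the last time. In the proof the guess is resolved
  by showing that a nonempty word which reduces to \<open>\<epsilon>\<close> is derivable under \<^emph>\<open>every\<close> choice of marks: to
  derive the word with the wanted marks through a given rule, the preceding word is taken with the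
  wanted marks and those which the rule needs (lemma \<open>step_lifts_to_marks\<close>). Conversely, a mark in
  a sentential form is always at the corresponding end, so erasing the marks turns a derivation into
  a reversed computation (lemma \<open>step_from_marked\<close>).
\<close>

lemma grammar_stepI:
  "(u, v) \<in> productions G \<Longrightarrow> grammar_step G (x @ u @ y) (x @ v @ y)"
  by (auto simp: grammar_step_def)

section \<open>From growing grammars to Cannon's algorithms\<close>

definition reversed_grammar :: "'s grammar \<Rightarrow> 's nca" where
  "reversed_grammar G = \<lparr>input_alphabet = terminals G, full_alphabet = grammar_alphabet G,
     rules =
       (\<lambda>(u, v). \<lparr>lhs = v, rhs = u, left_anchored = False, right_anchored = False\<rparr>) `
         {(u, v) \<in> productions G. u \<noteq> [start G]} \<union>
       (\<lambda>(u, v). \<lparr>lhs = v, rhs = [], left_anchored = True, right_anchored = True\<rparr>) `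
         {(u, v) \<in> productions G. u = [start G] \<and> v \<noteq> []}\<rparr>"

lemma growing_productionD:
  assumes "growing_context_sensitive G" and "(u, v) \<in> productions G"
  shows "u \<in> lists (grammar_alphabet G)" "v \<in> lists (grammar_alphabet G)" "u \<noteq> []"
    and "start G \<notin> set v" "u \<noteq> [start G] \<Longrightarrow> length u < length v"
  using assms
  unfolding growing_context_sensitive_def context_sensitive_def phrase_structure_grammar_def
    exceptional_production_def
  by fastforce+

lemma growing_phrase_structure:
  "growing_context_sensitive G \<Longrightarrow> phrase_structure_grammar G"
  by (simp add: growing_context_sensitive_def context_sensitive_def)

lemma cannon_algorithm_reversed_grammar:
  assumes "growing_context_sensitive G"
  shows "cannon_algorithm (reversed_grammar G)"
proof -
  have fin: "finite (productions G)" "finite (grammar_alphabet G)"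
    using growing_phrase_structure[OF assms]
    by (auto simp: phrase_structure_grammar_def grammar_alphabet_def)
  have "finite (rules (reversed_grammar G))"
    by (auto simp: reversed_grammar_def intro!: finite_imageI intro: finite_subset[OF _ fin(1)])
  moreover have "lhs r \<in> lists (grammar_alphabet G) \<and> rhs r \<in> lists (grammar_alphabet G) \<and>
      length (lhs r) > length (rhs r)" if "r \<in> rules (reversed_grammar G)" for r
    using that unfolding reversed_grammar_def
    by (auto simp del: in_lists_conv_set
        dest: growing_productionD[OF assms] simp: growing_productionD(5)[OF assms])
  ultimately show ?thesis
    using fin(2) by (auto simp: cannon_algorithm_def reversed_grammar_def grammar_alphabet_def)
qed

text \<open>A word to which a rule anchored on both sides applies is the right-hand side of a production
  for the start symbol. The derivation begins there, or at the empty word if the computation applies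
  no such rule.\<close>

lemma grammar_derivation_if_nca_computation:
  assumes "[] \<in> grammar_language G" and "(nca_step (reversed_grammar G))\<^sup>*\<^sup>* w []"
  shows "(grammar_step G)\<^sup>*\<^sup>* [start G] w"
  using assms(2)
proof (induction rule: converse_rtranclp_induct)
  case base
  then show ?case using assms(1) by (simp add: grammar_language_def)
next
  case (step w w')
  from step.hyps(1) consider
      (unanchored) x y u v where "(u, v) \<in> productions G" "w = x @ v @ y" "w' = x @ u @ y"
    | (anchored) "([start G], w) \<in> productions G"
    by (fastforce simp: nca_step_def reversed_grammar_def)
  then show ?case
  proof cases
    case unanchored
    then have "grammar_step G w' w" by (simp add: grammar_stepI)
    with step.IH show ?thesis by simp
  next
    case anchored
    then have "grammar_step G [start G] w"
      using grammar_stepI[of "[start G]" w G "[]" "[]"] by simp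
    then show ?thesis by simp
  qed
qed

text \<open>Tracking that the start symbol is absent after the first step is what guarantees that
  the anchored rules are needed only for the first production of a derivation.\<close>

lemma nca_computation_if_grammar_derivation:
  assumes "growing_context_sensitive G" and "(grammar_step G)\<^sup>*\<^sup>* [start G] w"
  shows "w = [start G] \<or> start G \<notin> set w \<and> w \<in> lists (grammar_alphabet G) \<and>
    (nca_step (reversed_grammar G))\<^sup>*\<^sup>* w []"
  using assms(2)
proof (induction rule: rtranclp_induct)
  case base
  then show ?case by simp
next
  case (step w w')
  from step.hyps(2) obtain u v x y where uv: "(u, v) \<in> productions G"
    and w: "w = x @ u @ y" and w': "w' = x @ v @ y"
    by (auto simp: grammar_step_def)
  note P = growing_productionD[OF assms(1) uv]
  show ?case
  proof (cases "w = [start G]")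
    case True
    with w P(3) have eq: "u = [start G]" "x = []" "y = []"
      by (auto simp: append_eq_Cons_conv Cons_eq_append_conv)
    let ?r = "\<lparr>lhs = v, rhs = [], left_anchored = True, right_anchored = True\<rparr>"
    have "nca_step (reversed_grammar G) v []" if "v \<noteq> []"
    proof -
      have "?r \<in> rules (reversed_grammar G)"
        using uv eq that by (force simp: reversed_grammar_def)
      then show ?thesis unfolding nca_step_def by (intro bexI[of _ ?r] bexI[of _ "[]"]) auto
    qed
    then show ?thesis using eq w' P by (cases "v = []") auto
  next
    case False
    with step.IH have IH: "start G \<notin> set w" "w \<in> lists (grammar_alphabet G)"
      "(nca_step (reversed_grammar G))\<^sup>*\<^sup>* w []" by auto
    let ?r = "\<lparr>lhs = v, rhs = u, left_anchored = False, right_anchored = False\<rparr>"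
    have "u \<noteq> [start G]" using IH(1) w by auto
    then have "?r \<in> rules (reversed_grammar G)"
      using uv by (force simp: reversed_grammar_def)
    moreover have "x \<in> lists (grammar_alphabet G)" "y \<in> lists (grammar_alphabet G)"
      using IH(2) w by auto
    ultimately have "nca_step (reversed_grammar G) w' w"
      unfolding nca_step_def w w'
      by (intro bexI[of _ ?r] bexI[of _ x] bexI[of _ y]) (auto simp: reversed_grammar_def)
    then show ?thesis using IH w w' P by (auto intro: converse_rtranclp_into_rtranclp)
  qed
qed

lemma nca_language_reversed_grammar:
  assumes "growing_context_sensitive G" and "[] \<in> grammar_language G"
  shows "nca_language (reversed_grammar G) = grammar_language G"
proof -
  have input: "input_alphabet (reversed_grammar G) = terminals G"
    by (simp add: reversed_grammar_def)
  have "[start G] \<notin> lists (terminals G)"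
    using growing_phrase_structure[OF assms(1)] by (auto simp: phrase_structure_grammar_def)
  then show ?thesis
    unfolding nca_language_def grammar_language_def input
    using grammar_derivation_if_nca_computation[OF assms(2)]
      nca_computation_if_grammar_derivation[OF assms(1)] by blast
qed

section \<open>Words with marked ends\<close>

text \<open>
  The value \<open>enc a l r\<close> is the letter \<open>a\<close> with a left mark if \<open>l\<close> and a right mark if \<open>r\<close>; both marks
  on one letter are needed for words of length one. Unmarked letters stand for themselves, so that
  fully unmarked sentential forms are words of the algorithm.
\<close>

locale marked_alphabet =
  fixes A :: "'s set" and enc :: "'s \<Rightarrow> bool \<Rightarrow> bool \<Rightarrow> 's" and \<sigma> :: 's
  assumes enc_inj: "\<lbrakk>a \<in> A; b \<in> A; enc a l r = enc b l' r'\<rbrakk> \<Longrightarrow> a = b \<and> l = l' \<and> r = r'"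
    and enc_unmarked: "enc a False False = a"
    and enc_not_start: "a \<in> A \<Longrightarrow> enc a l r \<noteq> \<sigma>"
begin

fun mark :: "bool \<Rightarrow> bool \<Rightarrow> 's list \<Rightarrow> 's list" where
  "mark l r [] = []"
| "mark l r (a # w) = enc a l (r \<and> w = []) # mark False r w"

lemma length_mark [simp]: "length (mark l r w) = length w"
  by (induction w arbitrary: l) auto

lemma mark_eq_Nil [simp]: "mark l r w = [] \<longleftrightarrow> w = []"
  by (cases w) auto

lemma mark_append: "mark l r (x @ y) = mark l (r \<and> y = []) x @ mark (l \<and> x = []) r y"
proof (induction x arbitrary: l)
  case (Cons a x)
  have "(r \<and> x @ y = []) = ((r \<and> y = []) \<and> x = [])" by auto
  then show ?case by (simp add: Cons.IH)
qed simp

lemma mark_unmarked [simp]: "mark False False w = w"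
  by (induction w) (auto simp: enc_unmarked)

lemma mark_in_lists: "w \<in> lists A \<Longrightarrow> mark l r w \<in> lists {enc a l r |a l r. a \<in> A}"
  by (induction w arbitrary: l) auto

lemma start_notin_mark: "w \<in> lists A \<Longrightarrow> \<sigma> \<notin> set (mark l r w)"
  using mark_in_lists[of w l r] enc_not_start by fastforce

lemma mark_inj:
  assumes "w \<in> lists A" "w' \<in> lists A" "mark l r w = mark l' r' w'"
  shows "w = w' \<and> (w \<noteq> [] \<longrightarrow> l = l' \<and> r = r')"
  using assms
proof (induction w arbitrary: l l' w' rule: list.induct)
  case Nil
  then have "mark l' r' w' = []" by simp
  then show ?case by (simp only: mark_eq_Nil) simp
next
  case (Cons a u)
  from Cons.prems(3) obtain a' u' where w': "w' = a' # u'" by (cases w') auto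
  have "a = a' \<and> l = l' \<and> (r \<and> u = []) = (r' \<and> u' = [])"
    using Cons.prems by (intro enc_inj) (auto simp: w')
  moreover have "u = u' \<and> (u \<noteq> [] \<longrightarrow> False = False \<and> r = r')"
    using Cons.prems by (intro Cons.IH) (auto simp: w')
  ultimately show ?case by (auto simp: w')
qed

lemma mark_eq_appendD:
  assumes "mark l r w = X @ Y"
  obtains x y where "w = x @ y" "X = mark l (r \<and> y = []) x" "Y = mark (l \<and> x = []) r y"
proof -
  define x y where "x = take (length X) w" and "y = drop (length X) w"
  have w: "w = x @ y" by (simp add: x_def y_def)
  have "length X \<le> length w" using arg_cong[OF assms, of length] by simp
  then have "length x = length X" by (simp add: x_def)
  then have "mark l (r \<and> y = []) x = X \<and> mark (l \<and> x = []) r y = Y"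
    using assms unfolding w mark_append by (subst (asm) append_eq_append_conv) simp_all
  with w that show thesis by blast
qed

text \<open>The three-part form in which a rewriting step sees a marked word. Since the middle part is
  nonempty, a mark on it lies at the corresponding end of the whole word.\<close>

lemma mark_append3:
  assumes "m \<noteq> []"
  shows "mark l r (x @ m @ y) =
    mark l False x @ mark (l \<and> x = []) (r \<and> y = []) m @ mark False r y"
  using assms by (simp add: mark_append)

lemma mark_eq_append3D:
  assumes "mark l r w = X @ mark l1 r1 m @ Y" "w \<in> lists A" "m \<in> lists A" "m \<noteq> []"
  obtains x y where "w = x @ m @ y" "X = mark l False x" "Y = mark False r y"
    "l1 = (l \<and> x = [])" "r1 = (r \<and> y = [])"
proof -
  obtain x w2 where x: "w = x @ w2" "X = mark l (r \<and> w2 = []) x"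
    and w2: "mark l1 r1 m @ Y = mark (l \<and> x = []) r w2"
    using mark_eq_appendD[OF assms(1)] .
  obtain m' y where y: "w2 = m' @ y" "mark l1 r1 m = mark (l \<and> x = []) (r \<and> y = []) m'"
    "Y = mark ((l \<and> x = []) \<and> m' = []) r y"
    using mark_eq_appendD[OF w2[symmetric]] .
  have "m' \<in> lists A" using x(1) y(1) assms(2) by auto
  from mark_inj[OF assms(3) this y(2)] assms(4)
  have m: "m' = m" "l1 = (l \<and> x = [])" "r1 = (r \<and> y = [])" by auto
  have "(r \<and> w2 = []) = False" "((l \<and> x = []) \<and> m' = []) = False"
    using y(1) m(1) assms(4) by auto
  with x y m show thesis by (intro that[of x y]) (simp_all only: append_assoc)
qed

end

text \<open>Take a sequence of distinct symbols outside the alphabet: its first member serves as the start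
  symbol, the others as marked letters.\<close>

lemma marked_alphabet_exists:
  fixes A :: "'s set"
  assumes "finite A" and "infinite (UNIV :: 's set)"
  obtains enc \<sigma> where "marked_alphabet A enc \<sigma>" "\<sigma> \<notin> A"
proof -
  have "infinite (- A)" using assms by (simp add: finite_compl)
  then obtain f :: "nat \<Rightarrow> 's" where f: "inj f" "range f \<subseteq> - A"
    using infinite_countable_subset by blast
  obtain g :: "'s \<times> bool \<times> bool \<Rightarrow> nat" where g: "inj_on g (A \<times> UNIV)"
    using finite_imp_inj_to_nat_seg[of "A \<times> (UNIV :: (bool \<times> bool) set)"] assms(1)
    by (auto simp: finite_prod)
  have fA: "f n \<notin> A" for n using f(2) by auto
  define enc where "enc a l r = (if l \<or> r then f (Suc (g (a, l, r))) else a)" for a l r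
  have "marked_alphabet A enc (f 0)"
  proof
    fix a b l r l' r' assume ab: "a \<in> A" "b \<in> A" "enc a l r = enc b l' r'"
    show "a = b \<and> l = l' \<and> r = r'"
    proof (cases "(l \<or> r) \<and> (l' \<or> r')")
      case True
      then have "g (a, l, r) = g (b, l', r')"
        using ab(3) f(1) by (auto simp: enc_def inj_eq)
      then show ?thesis using g ab(1,2) by (auto dest: inj_onD)
    next
      case False
      then show ?thesis using ab fA unfolding enc_def by (auto split: if_splits)
    qed
  next
    fix a l r assume "a \<in> A"
    then show "enc a l r \<noteq> f 0" using f(1) fA by (auto simp: enc_def inj_eq)
  qed (simp add: enc_def)
  with fA that show thesis by blast
qed

section \<open>From Cannon's algorithms to growing grammars\<close>

locale marked_cannon = marked_alphabet "full_alphabet M" enc \<sigma>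
  for M :: "'s nca" and enc \<sigma> +
  assumes cannon: "cannon_algorithm M" and start_fresh: "\<sigma> \<notin> full_alphabet M"
begin

abbreviation A :: "'s set" where "A \<equiv> full_alphabet M"

text \<open>The context letters \<open>p\<close> and \<open>q\<close> provide the letter next to which \<open>\<epsilon>\<close> is replaced. An anchored
  rule requires a mark, and marks may be lost but not created.\<close>

definition rewriting_productions :: "('s list \<times> 's list) set" where
  "rewriting_productions = {(mark l r (p @ rhs \<rho> @ q), mark l' r' (p @ lhs \<rho> @ q)) |\<rho> p q l r l' r'.
     \<rho> \<in> rules M \<and> p \<in> lists A \<and> q \<in> lists A \<and> length p \<le> 1 \<and> length q \<le> 1 \<and>
     p @ rhs \<rho> @ q \<noteq> [] \<and> (l' \<longrightarrow> l) \<and> (r' \<longrightarrow> r) \<and>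
     (left_anchored \<rho> \<longrightarrow> p = [] \<and> l) \<and> (right_anchored \<rho> \<longrightarrow> q = [] \<and> r)}"

definition initial_productions :: "('s list \<times> 's list) set" where
  "initial_productions = {([\<sigma>], mark l r (lhs \<rho>)) |\<rho> l r. \<rho> \<in> rules M \<and> rhs \<rho> = []}"

definition marked_grammar :: "'s grammar" where
  "marked_grammar = \<lparr>
     nonterminals = insert \<sigma> {enc a l r |a l r. a \<in> A} - input_alphabet M,
     terminals = input_alphabet M,
     start = \<sigma>,
     productions = insert ([\<sigma>], []) (initial_productions \<union> rewriting_productions)\<rparr>"

lemma ruleD:
  assumes "\<rho> \<in> rules M"
  shows "lhs \<rho> \<in> lists A" "rhs \<rho> \<in> lists A" "length (rhs \<rho>) < length (lhs \<rho>)"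
  using cannon assms by (auto simp: cannon_algorithm_def)

lemma input_subset: "input_alphabet M \<subseteq> A"
  using cannon by (simp add: cannon_algorithm_def)

lemma alphabet_marked_grammar:
  "grammar_alphabet marked_grammar = insert \<sigma> {enc a l r |a l r. a \<in> A}"
proof -
  have "a \<in> {enc a l r |a l r. a \<in> A}" if "a \<in> A" for a
    using that by (intro CollectI exI[of _ a] exI[of _ False]) (simp add: enc_unmarked)
  then show ?thesis using input_subset by (auto simp: grammar_alphabet_def marked_grammar_def)
qed

lemma mark_in_grammar_alphabet:
  "w \<in> lists A \<Longrightarrow> mark l r w \<in> lists (grammar_alphabet marked_grammar)"
  unfolding alphabet_marked_grammar using mark_in_lists[of w l r] by auto

lemma finite_productions: "finite (productions marked_grammar)"
proof -
  have fin: "finite (rules M)" "finite A" using cannon by (auto simp: cannon_algorithm_def)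
  let ?C = "{p. set p \<subseteq> A \<and> length p \<le> 1}"
  let ?B = "UNIV :: bool set"
  have C: "finite ?C" using finite_lists_length_le[OF fin(2)] .
  let ?f = "\<lambda>(\<rho>, p, q, l, r, l', r'). (mark l r (p @ rhs \<rho> @ q), mark l' r' (p @ lhs \<rho> @ q))"
  have "rewriting_productions \<subseteq> ?f ` (rules M \<times> ?C \<times> ?C \<times> ?B \<times> ?B \<times> ?B \<times> ?B)"
  proof
    fix z assume "z \<in> rewriting_productions"
    then obtain \<rho> p q l r l' r' where
      "z = (mark l r (p @ rhs \<rho> @ q), mark l' r' (p @ lhs \<rho> @ q))" "\<rho> \<in> rules M"
      "p \<in> ?C" "q \<in> ?C"
      unfolding rewriting_productions_def in_lists_conv_set by blast
    then show "z \<in> ?f ` (rules M \<times> ?C \<times> ?C \<times> ?B \<times> ?B \<times> ?B \<times> ?B)"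
      by (intro image_eqI[of _ _ "(\<rho>, p, q, l, r, l', r')"]) simp_all
  qed
  then have "finite rewriting_productions"
    by (rule finite_subset) (intro finite_imageI finite_cartesian_product fin(1) C finite)
  moreover have "initial_productions \<subseteq>
      (\<lambda>(\<rho>, l, r). ([\<sigma>], mark l r (lhs \<rho>))) ` (rules M \<times> ?B \<times> ?B)"
    unfolding initial_productions_def by (force simp: image_iff)
  then have "finite initial_productions"
    by (rule finite_subset) (intro finite_imageI finite_cartesian_product fin(1) finite)
  ultimately show ?thesis by (simp add: marked_grammar_def)
qed

lemma rewriting_productionD:
  assumes "(u, v) \<in> rewriting_productions"
  shows "u \<in> lists (grammar_alphabet marked_grammar)" "v \<in> lists (grammar_alphabet marked_grammar)"
    "u \<noteq> []" "\<sigma> \<notin> set u" "\<sigma> \<notin> set v" "length u < length v"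
proof -
  obtain \<rho> p q l r l' r' where u: "u = mark l r (p @ rhs \<rho> @ q)" and v: "v = mark l' r' (p @ lhs \<rho> @ q)"
    and \<rho>: "\<rho> \<in> rules M" and pq: "p \<in> lists A" "q \<in> lists A" and ne: "p @ rhs \<rho> @ q \<noteq> []"
    using assms unfolding rewriting_productions_def by blast
  have A: "p @ rhs \<rho> @ q \<in> lists A" "p @ lhs \<rho> @ q \<in> lists A"
    using pq ruleD[OF \<rho>] by auto
  show "u \<in> lists (grammar_alphabet marked_grammar)" "v \<in> lists (grammar_alphabet marked_grammar)"
    "\<sigma> \<notin> set u" "\<sigma> \<notin> set v"
    unfolding u v using mark_in_grammar_alphabet start_notin_mark A by blast+
  show "u \<noteq> []" "length u < length v"
    using ne ruleD(3)[OF \<rho>] unfolding u v by auto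
qed

lemma initial_productionD:
  assumes "(u, v) \<in> initial_productions"
  shows "u = [\<sigma>]" "v \<in> lists (grammar_alphabet marked_grammar)" "\<sigma> \<notin> set v" "v \<noteq> []"
  using assms ruleD mark_in_grammar_alphabet start_notin_mark
  unfolding initial_productions_def by fastforce+

lemma growing_marked_grammar: "growing_context_sensitive marked_grammar"
proof -
  have G: "start marked_grammar = \<sigma>" "productions marked_grammar =
      insert ([\<sigma>], []) (initial_productions \<union> rewriting_productions)"
    by (simp_all add: marked_grammar_def)
  have fin: "finite (nonterminals marked_grammar)" "finite (terminals marked_grammar)"
  proof -
    have "finite A" using cannon by (simp add: cannon_algorithm_def)
    moreover have "{enc a l r |a l r. a \<in> A} =
        (\<lambda>(a, l, r). enc a l r) ` (A \<times> (UNIV :: bool set) \<times> (UNIV :: bool set))"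
      by (force simp: image_iff)
    ultimately have "finite {enc a l r |a l r. a \<in> A}" by simp
    then show "finite (nonterminals marked_grammar)" by (simp add: marked_grammar_def)
    show "finite (terminals marked_grammar)"
      using \<open>finite A\<close> input_subset by (auto simp: marked_grammar_def intro: finite_subset)
  qed
  have \<sigma>: "\<sigma> \<in> nonterminals marked_grammar" "\<sigma> \<in> grammar_alphabet marked_grammar"
    "nonterminals marked_grammar \<inter> terminals marked_grammar = {}"
    using start_fresh input_subset by (auto simp: marked_grammar_def grammar_alphabet_def)
  have "phrase_structure_grammar marked_grammar"
    unfolding phrase_structure_grammar_def
    using fin \<sigma> finite_productions rewriting_productionD(1-3) initial_productionD(1,2)
    unfolding G by fastforce
  moreover have "exceptional_production marked_grammar u v" if "(u, v) = ([\<sigma>], [])" for u v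
    using that rewriting_productionD(5) initial_productionD(3)
    unfolding exceptional_production_def G by fastforce
  moreover have "length u \<le> length v \<and> \<sigma> \<notin> set v \<and> (u = [\<sigma>] \<or> length u < length v)"
    if "(u, v) \<in> initial_productions \<union> rewriting_productions" for u v
    using that rewriting_productionD(5,6)[of u v] initial_productionD[of u v]
    by (auto simp: Suc_le_eq)
  ultimately show ?thesis
    unfolding growing_context_sensitive_def context_sensitive_def G by blast
qed

text \<open>The marks that an anchored rule needs are added to the shorter word and dropped again by the
  production. They do not disturb the unaffected parts: an unaffected part that could carry an
  additional mark would be empty.\<close>

lemma step_lifts_to_marks:
  assumes "nca_step M w w'" and "w' \<noteq> []"
  shows "\<exists>l' r'. grammar_step marked_grammar (mark l' r' w') (mark l r w)"
proof -
  from assms(1) obtain \<rho> x y where \<rho>: "\<rho> \<in> rules M" and xy: "x \<in> lists A" "y \<in> lists A"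
    and w: "w = x @ lhs \<rho> @ y" and w': "w' = x @ rhs \<rho> @ y"
    and anchors: "left_anchored \<rho> \<longrightarrow> x = []" "right_anchored \<rho> \<longrightarrow> y = []"
    by (auto simp: nca_step_def)
  \<comment> \<open>One letter of context is taken on each side where there is one. Thus the left-hand side of the
    production is nonempty, and an anchored side gets no context.\<close>
  obtain x0 p where x: "x = x0 @ p" "length p \<le> 1" "p = [] \<longrightarrow> x = []"
  proof (cases x rule: rev_cases)
    case (snoc x0 a)
    then show ?thesis by (intro that[of x0 "[a]"]) auto
  qed (auto intro: that[of "[]" "[]"])
  obtain q y0 where y: "y = q @ y0" "length q \<le> 1" "q = [] \<longrightarrow> y = []"
  proof (cases y)
    case (Cons a y0)
    then show ?thesis by (intro that[of "[a]" y0]) auto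
  qed (auto intro: that[of "[]" "[]"])
  let ?u = "p @ rhs \<rho> @ q" and ?v = "p @ lhs \<rho> @ q"
  let ?l = "l \<or> left_anchored \<rho>" and ?r = "r \<or> right_anchored \<rho>"
  have ne: "?u \<noteq> []" "?v \<noteq> []" using assms(2) w' x y ruleD(3)[OF \<rho>] by auto
  have "mark ?l ?r w' = mark ?l False x0 @ mark (?l \<and> x0 = []) (?r \<and> y0 = []) ?u @ mark False ?r y0"
    using mark_append3[OF ne(1)] w' x(1) y(1) by simp
  moreover have "mark ?l False x0 = mark l False x0" "mark False ?r y0 = mark False r y0"
    using anchors x(1) y(1) by (cases "x0 = []"; cases "y0 = []"; auto)+
  moreover have "mark l r w = mark l False x0 @ mark (l \<and> x0 = []) (r \<and> y0 = []) ?v @ mark False r y0"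
    using mark_append3[OF ne(2)] w x(1) y(1) by simp
  moreover have "(mark (?l \<and> x0 = []) (?r \<and> y0 = []) ?u, mark (l \<and> x0 = []) (r \<and> y0 = []) ?v)
      \<in> rewriting_productions"
    unfolding rewriting_productions_def using \<rho> xy x y anchors ne
    by (intro CollectI exI conjI) (rule refl | force)+
  then have "(mark (?l \<and> x0 = []) (?r \<and> y0 = []) ?u, mark (l \<and> x0 = []) (r \<and> y0 = []) ?v)
      \<in> productions marked_grammar" by (simp add: marked_grammar_def)
  ultimately have "grammar_step marked_grammar (mark ?l ?r w') (mark l r w)"
    by (simp only: grammar_stepI)
  then show ?thesis by blast
qed

lemma marked_derivation_if_computation:
  assumes "(nca_step M)\<^sup>*\<^sup>* w []" and "w \<noteq> []"
  shows "(grammar_step marked_grammar)\<^sup>*\<^sup>* [\<sigma>] (mark l r w)"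
  using assms
proof (induction arbitrary: l r rule: converse_rtranclp_induct)
  case base
  then show ?case by simp
next
  case (step w w')
  show ?case
  proof (cases "w' = []")
    case True
    with step.hyps(1) obtain \<rho> where "\<rho> \<in> rules M" "rhs \<rho> = []" "w = lhs \<rho>"
      by (auto simp: nca_step_def)
    then have "([\<sigma>], mark l r w) \<in> initial_productions"
      by (auto simp: initial_productions_def)
    then have "grammar_step marked_grammar [\<sigma>] (mark l r w)"
      using grammar_stepI[of "[\<sigma>]" "mark l r w" marked_grammar "[]" "[]"]
      by (simp add: marked_grammar_def)
    then show ?thesis by simp
  next
    case False
    with step step_lifts_to_marks show ?thesis by (meson rtranclp.rtrancl_into_rtrancl)
  qed
qed

text \<open>Marks left by the production are at the ends of the new word, because they were there before
  the step and a production does not move them away from the ends of the replaced part.\<close>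

lemma step_from_marked:
  assumes "grammar_step marked_grammar (mark l r w) z" and "w \<in> lists A" "w \<noteq> []"
  shows "\<exists>l' r' w'. z = mark l' r' w' \<and> w' \<in> lists A \<and> w' \<noteq> [] \<and> nca_step M w' w"
proof -
  obtain u v X Y where uv: "(u, v) \<in> productions marked_grammar"
    and w: "mark l r w = X @ u @ Y" and z: "z = X @ v @ Y"
    using assms(1) by (auto simp: grammar_step_def)
  have "\<sigma> \<notin> set u" using start_notin_mark[OF assms(2), of l r] w by auto
  then have "(u, v) \<in> rewriting_productions"
    using uv initial_productionD(1) by (fastforce simp: marked_grammar_def)
  then obtain \<rho> p q l1 r1 l2 r2 where u: "u = mark l1 r1 (p @ rhs \<rho> @ q)"
    and v: "v = mark l2 r2 (p @ lhs \<rho> @ q)"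
    and \<rho>: "\<rho> \<in> rules M" and pq: "p \<in> lists A" "q \<in> lists A" and ne: "p @ rhs \<rho> @ q \<noteq> []"
    and marks: "l2 \<longrightarrow> l1" "r2 \<longrightarrow> r1"
    and anchors: "left_anchored \<rho> \<longrightarrow> p = [] \<and> l1" "right_anchored \<rho> \<longrightarrow> q = [] \<and> r1"
    unfolding rewriting_productions_def by blast
  have "p @ rhs \<rho> @ q \<in> lists A" using pq ruleD[OF \<rho>] by auto
  with w[unfolded u] obtain x y where xy: "w = x @ (p @ rhs \<rho> @ q) @ y"
    "X = mark l False x" "Y = mark False r y" and l1: "l1 = (l \<and> x = [])" and r1: "r1 = (r \<and> y = [])"
    using mark_eq_append3D assms(2) ne by metis
  let ?w = "x @ (p @ lhs \<rho> @ q) @ y"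
  \<comment> \<open>An end untouched by the production keeps its mark.\<close>
  let ?l = "if x = [] then l2 else l" and ?r = "if y = [] then r2 else r"
  have "p @ lhs \<rho> @ q \<noteq> []" using ruleD(3)[OF \<rho>] by auto
  from mark_append3[OF this, of ?l ?r x y]
  have "mark ?l ?r ?w = mark ?l False x @ mark (?l \<and> x = []) (?r \<and> y = []) (p @ lhs \<rho> @ q) @
      mark False ?r y" .
  moreover have "mark ?l False x = X" "mark False ?r y = Y" using xy by auto
  moreover have "(?l \<and> x = []) = l2" "(?r \<and> y = []) = r2" using marks l1 r1 by auto
  ultimately have "z = mark ?l ?r ?w" unfolding z v by simp
  moreover have A: "x \<in> lists A" "y \<in> lists A" "lhs \<rho> \<in> lists A"
    using assms(2) xy(1) ruleD[OF \<rho>] by auto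
  moreover have "nca_step M ?w w"
    unfolding nca_step_def using \<rho> A pq anchors l1 r1 xy(1)
    by (intro bexI[of _ \<rho>] bexI[of _ "x @ p"] bexI[of _ "q @ y"]) auto
  moreover have "?w \<in> lists A" "?w \<noteq> []" using A pq ruleD(3)[OF \<rho>] by auto
  ultimately show ?thesis by blast
qed

lemma computation_if_marked_derivation:
  assumes "(grammar_step marked_grammar)\<^sup>*\<^sup>* [\<sigma>] z"
  shows "z = [\<sigma>] \<or> z = [] \<or>
    (\<exists>l r w. z = mark l r w \<and> w \<in> lists A \<and> w \<noteq> [] \<and> (nca_step M)\<^sup>*\<^sup>* w [])"
  using assms
proof (induction rule: rtranclp_induct)
  case base
  then show ?case by simp
next
  case (step z z')
  from step.IH consider (start) "z = [\<sigma>]" | (empty) "z = []"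
    | (marked) l r w where "z = mark l r w" "w \<in> lists A" "w \<noteq> []" "(nca_step M)\<^sup>*\<^sup>* w []"
    by blast
  then show ?case
  proof cases
    case start
    from step.hyps(2) obtain u v x y where uv: "(u, v) \<in> productions marked_grammar"
      and z: "z = x @ u @ y" "z' = x @ v @ y" by (auto simp: grammar_step_def)
    have "u \<noteq> []" using uv rewriting_productionD(3) initial_productionD(1)
      by (fastforce simp: marked_grammar_def)
    with z start have eq: "u = [\<sigma>]" "z' = v"
      by (auto simp: append_eq_Cons_conv Cons_eq_append_conv)
    then have "(u, v) \<notin> rewriting_productions" using rewriting_productionD(4) by fastforce
    then consider "v = []" | l r \<rho> where "v = mark l r (lhs \<rho>)" "\<rho> \<in> rules M" "rhs \<rho> = []"
      using uv by (auto simp: marked_grammar_def initial_productions_def)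
    then show ?thesis
    proof cases
      case 2
      then have "nca_step M (lhs \<rho>) []"
        unfolding nca_step_def by (intro bexI[of _ \<rho>] bexI[of _ "[]"]) auto
      with 2 eq ruleD[OF 2(2)] show ?thesis by fastforce
    qed (use eq in simp)
  next
    case empty
    then show ?thesis
      using step.hyps(2) rewriting_productionD(3) initial_productionD(1)
      by (fastforce simp: grammar_step_def marked_grammar_def)
  next
    case marked
    then show ?thesis
      using step_from_marked[of l r w z'] step.hyps(2)
      by (metis converse_rtranclp_into_rtranclp)
  qed
qed

lemma language_marked_grammar: "grammar_language marked_grammar = nca_language M"
proof (intro set_eqI iffI)
  fix z assume "z \<in> grammar_language marked_grammar"
  then have z: "z \<in> lists (input_alphabet M)" "(grammar_step marked_grammar)\<^sup>*\<^sup>* [\<sigma>] z"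
    by (auto simp: grammar_language_def marked_grammar_def)
  have "z \<noteq> [\<sigma>]" using z(1) input_subset start_fresh by auto
  then consider "z = []"
    | l r w where "z = mark l r w" "w \<in> lists A" "(nca_step M)\<^sup>*\<^sup>* w []"
    using computation_if_marked_derivation[OF z(2)] by blast
  then have "(nca_step M)\<^sup>*\<^sup>* z []"
  proof cases
    case 2
    have "z \<in> lists A" using z(1) input_subset by auto
    \<comment> \<open>A terminal word is the marking of itself without marks.\<close>
    then have "w = z" using mark_inj[OF 2(2) \<open>z \<in> lists A\<close>, of l r False False] 2(1)[symmetric]
      by simp
    with 2(3) show ?thesis by simp
  qed simp
  with z(1) show "z \<in> nca_language M" by (simp add: nca_language_def)
next
  fix z assume "z \<in> nca_language M"
  then have z: "z \<in> lists (input_alphabet M)" "(nca_step M)\<^sup>*\<^sup>* z []"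
    by (auto simp: nca_language_def)
  have "(grammar_step marked_grammar)\<^sup>*\<^sup>* [\<sigma>] z"
  proof (cases "z = []")
    case True
    have "grammar_step marked_grammar [\<sigma>] []"
      using grammar_stepI[of "[\<sigma>]" "[]" marked_grammar "[]" "[]"]
      by (simp add: marked_grammar_def)
    then show ?thesis using True by simp
  next
    case False
    then show ?thesis using marked_derivation_if_computation[OF z(2), of False False] by simp
  qed
  with z(1) show "z \<in> grammar_language marked_grammar"
    by (simp add: grammar_language_def marked_grammar_def)
qed

end

theorem theorem3:
  fixes X :: "'a set" and L :: "'a list set"
  assumes "finite X" and "L \<subseteq> lists X" and "[] \<in> L"
  shows "growing_context_sensitive_language X L \<longleftrightarrow> language_of_nca X L"
proof
  assume "growing_context_sensitive_language X L"
  then obtain G :: "('a + nat) grammar" where G: "growing_context_sensitive G"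
    "terminals G = Inl ` X" "grammar_language G = map Inl ` L"
    by (auto simp: growing_context_sensitive_language_def)
  have "[] \<in> grammar_language G" using G(3) assms(3) by force
  then show "language_of_nca X L"
    unfolding language_of_nca_def
    using G cannon_algorithm_reversed_grammar[OF G(1)] nca_language_reversed_grammar[OF G(1)]
    by (intro exI[of _ "reversed_grammar G"]) (simp add: reversed_grammar_def)
next
  assume "language_of_nca X L"
  then obtain M :: "('a + nat) nca" where M: "cannon_algorithm M"
    "input_alphabet M = Inl ` X" "nca_language M = map Inl ` L"
    by (auto simp: language_of_nca_def)
  have "finite (full_alphabet M)" using M(1) by (simp add: cannon_algorithm_def)
  moreover have "infinite (UNIV :: ('a + nat) set)" by simp
  ultimately obtain enc \<sigma> where enc: "marked_alphabet (full_alphabet M) enc \<sigma>" "\<sigma> \<notin> full_alphabet M"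
    by (rule marked_alphabet_exists)
  interpret marked_cannon M enc \<sigma>
    using enc M(1) by (simp add: marked_cannon_def marked_cannon_axioms_def)
  have "terminals marked_grammar = Inl ` X" by (simp add: marked_grammar_def M(2))
  then show "growing_context_sensitive_language X L"
    unfolding growing_context_sensitive_language_def
    using growing_marked_grammar language_marked_grammar M(3) by metis
qed

end
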